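(* Consider the problem of minimizing $f=\sum_{i=1}^m f_i$ over $X$, and suppose that Assumption 1 (common optimal solution) and Assumption 2 (Hölder condition of order $p>0$) stated in the context hold. Let $\{x_k\}$ be a sequence generated by the incremental subgradient method described in the context. Let $x^*\in X^*$ and $\sigma>0$, and suppose that $\mathbf{B}(x^*,\sigma)\subseteq X^*$, where $\mathbf{B}(x^*,\sigma)$ is the closed ball of radius $\sigma$ centered at $x^*$. Then $x_k\in X^*$ for some $k\in\mathbb{N}$, provided that one of the following conditions holds: (i) $v_k=v\in\left(0,\frac{2\sigma}{m}\right)$ for any $k\in\mathbb{N}$; (ii) the sequence $\{v_k\}$ satisfies the diminishing stepsize rule: $v_k>0$, $\lim_{k\to\infty}v_k=0$ and $\sum_{k=0}^\infty v_k=\infty$.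
   Context: Setting. $X\subseteq\mathbb{R}^n$ is nonempty, closed and convex, and $f_1,\dots,f_m:\mathbb{R}^n\to\mathbb{R}$ are continuous and quasi-convex (a function $h$ is quasi-convex if $h((1-\alpha)x+\alpha y)\le\max\{h(x),h(y)\}$ for all $x,y\in\mathbb{R}^n$, $\alpha\in[0,1]$). Put $f:=\sum_{i=1}^m f_i$ ($f$ need not be quasi-convex), $f^*:=\min_{x\in X}f(x)$, $X^*:=\arg\min_{x\in X}f(x)$, $f_i^*:=\min_{x\in X}f_i(x)$, $X_i^*:=\arg\min_{x\in X}f_i(x)$. $\mathbb{N}=\{0,1,2,\dots\}$; $\|\cdot\|$ is the Euclidean norm, $P_X$ the Euclidean projection onto $X$, and $S(0,1)$ the unit sphere. Assumption 1. The component functions have a common optimal solution over $X$ (equivalently $X^*=\bigcap_{i=1}^m X_i^*\neq\emptyset$). Assumption 2. $p>0$, $L_i>0$ for $i=1,\dots,m$, and for each $i$, $|f_i(y)-f_i(x)|\le L_i\|y-x\|^p$ for all $x\in X$ and all $y\in\mathbb{R}^n$. Quasi-subdifferential. For quasi-convex $h:\mathbb{R}^n\to\mathbb{R}$ and $x\in\mathbb{R}^n$, $\partial h(x):=\{g:\langle g,y-x\rangle\le 0\text{ for every } y \text{ with } h(y)<h(x)\}$. Incremental subgradient method. Initialize an initial point $x_0\in\mathbb{R}^n$, a stepsize sequence $\{v_k\}$, and $k:=0$. While $f(x_k)>f^*$: set $z_{k,0}:=x_k$; for $i=1,\dots,m$: if $f_i(z_{k,i-1})=f_i^*$, set $z_{k,i}:=z_{k,i-1}$;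 otherwise calculate $g_{k,i}\in\partial f_i(z_{k,i-1})\cap S(0,1)$ and set $z_{k,i}:=P_X(z_{k,i-1}-v_kg_{k,i})$. Then set $x_{k+1}:=z_{k,m}$ and $k:=k+1$.
   Formalization: The formal theorem assumes x_0 ∈ X or f(x_0) > f^*; otherwise the method stops at once at x_0 ∉ X and the claim fails (X=[0,10], f(t)=max(0,t−5), x_0=−1). *)

theory Defs
  imports "HOL-Analysis.Analysis" "HOL-Library.Extended_Nat"
begin

definition quasi_convex :: "('a::real_vector \<Rightarrow> real) \<Rightarrow> bool" where
  "quasi_convex h \<longleftrightarrow>
     (\<forall>x y. \<forall>\<alpha>\<in>{0..1}. h ((1 - \<alpha>) *\<^sub>R x + \<alpha> *\<^sub>R y) \<le> max (h x) (h y))"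

definition argmin_set :: "'a set \<Rightarrow> ('a \<Rightarrow> real) \<Rightarrow> 'a set" where
  "argmin_set X h = {x. is_arg_min h (\<lambda>x. x \<in> X) x}"

(* Only meaningful when h attains its minimum over X, i.e. when argmin_set X h is nonempty;
   the infimum is then that minimum. *)
definition min_value :: "'a set \<Rightarrow> ('a \<Rightarrow> real) \<Rightarrow> real" where
  "min_value X h = (INF x\<in>X. h x)"

definition quasi_subdiff :: "('a::real_inner \<Rightarrow> real) \<Rightarrow> 'a \<Rightarrow> 'a set" where
  "quasi_subdiff h x = {g. \<forall>y. h y < h x \<longrightarrow> g \<bullet> (y - x) \<le> 0}"

(* For closed, convex, nonempty X, closest_point X is the Euclidean projection onto X. *)
definition inner_step ::
    "'a::euclidean_space set \<Rightarrow> ('a \<Rightarrow> real) \<Rightarrow> real \<Rightarrow> 'a \<Rightarrow> 'a \<Rightarrow> bool" where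
  "inner_step X h s z z' \<longleftrightarrow>
     (if h z = min_value X h then z' = z
      else \<exists>g \<in> quasi_subdiff h z \<inter> sphere 0 1. z' = closest_point X (z - s *\<^sub>R g))"

definition outer_step ::
    "'a::euclidean_space set \<Rightarrow> nat \<Rightarrow> (nat \<Rightarrow> 'a \<Rightarrow> real) \<Rightarrow> real \<Rightarrow> 'a \<Rightarrow> 'a \<Rightarrow> bool" where
  "outer_step X m f s x x' \<longleftrightarrow>
     (\<exists>z :: nat \<Rightarrow> 'a. z 0 = x \<and> (\<forall>i\<in>{1..m}. inner_step X (f i) s (z (i - 1)) (z i)) \<and> x' = z m)"

(* The while loop may stop, so a run consists of the iterates x k with k \<le> K, where K is the
   index of the last iterate (K = \<infinity> if the loop never stops).  The values x k with k > K are
   not part of the run. *)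
definition incremental_subgradient_run ::
    "'a::euclidean_space set \<Rightarrow> nat \<Rightarrow> (nat \<Rightarrow> 'a \<Rightarrow> real) \<Rightarrow> (nat \<Rightarrow> real) \<Rightarrow> (nat \<Rightarrow> 'a) \<Rightarrow> enat \<Rightarrow> bool"
  where
  "incremental_subgradient_run X m f v x K \<longleftrightarrow>
     (let F = (\<lambda>y. \<Sum>i=1..m. f i y) in
       (\<forall>k. enat k < K \<longrightarrow> F (x k) > min_value X F \<and> outer_step X m f (v k) (x k) (x (Suc k))) \<and>
       (\<forall>k. enat k = K \<longrightarrow> \<not> F (x k) > min_value X F))"

end

theory Submission imports Defs begin

text \<open>
  The proof is a Fejer-type argument around the centre \<open>xs\<close> of the ball of solutions.  Because the
  components share a minimizer over \<open>X\<close>, a minimizer of the sum minimizes every component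
  (\<open>argmin_set_sum_subset\<close>), so the whole ball \<open>cball xs \<sigma>\<close> consists of minimizers of each \<open>f i\<close>.
  Suppose a component is not yet optimal at \<open>z \<in> X\<close>, and let \<open>g\<close> be a unit quasi-subgradient there.
  Every point of the ball has a smaller value than \<open>z\<close>, so \<open>w \<mapsto> g \<bullet> (w - z)\<close> is nonpositive on the
  ball; testing with the point \<open>xs + \<sigma> *\<^sub>R g\<close> gives \<open>g \<bullet> (z - xs) \<ge> \<sigma>\<close>.  Expanding the square and
  using that the projection onto \<open>X\<close> is nonexpansive and fixes \<open>xs\<close>, a step of size \<open>s\<close> lowers the
  squared distance to \<open>xs\<close> by at least \<open>s * (2 * \<sigma> - s)\<close> (\<open>closest_point_subgradient_descent\<close>).

  As long as the current iterate is not optimal for the sum, some component is not optimal at the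
  point where its turn comes, so each pass that starts in \<open>X\<close> makes at least one such step, and its
  remaining steps do no harm when \<open>s \<le> 2 * \<sigma>\<close> (\<open>outer_step_descent\<close>).  Only the starting point can
  lie outside \<open>X\<close>, because a pass that moves at all ends in \<open>X\<close>.  Under either stepsize rule
  \<open>2 * \<sigma> - v k\<close> is eventually bounded below by some \<open>e > 0\<close> and the stepsizes have infinite sum.  A
  run that never stops would therefore push a squared distance below zero.  A run that stops
  does so at a point of \<open>X\<close>, which is then a minimizer.
\<close>

lemma min_value_eq:
  assumes "y \<in> argmin_set X h"
  shows "min_value X h = h y"
  unfolding min_value_def
  by (rule cInf_eq_minimum) (use assms in \<open>auto simp: argmin_set_def is_arg_min_linorder\<close>)

text \<open>
  At a minimizer of the sum no summand can lie strictly above its own minimum: the other summands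
  cannot go below theirs, so the total would exceed the value at a common minimizer.
\<close>

lemma argmin_set_sum_subset:
  fixes f :: "'i \<Rightarrow> 'a \<Rightarrow> real"
  assumes "finite I" and c: "c \<in> (\<Inter>i\<in>I. argmin_set X (f i))" and i: "i \<in> I"
  shows "argmin_set X (\<lambda>y. \<Sum>i\<in>I. f i y) \<subseteq> argmin_set X (f i)"
proof
  have "c \<in> X"
    using c i by (auto simp: argmin_set_def is_arg_min_def)
  fix y assume y: "y \<in> argmin_set X (\<lambda>y. \<Sum>i\<in>I. f i y)"
  then have yX: "y \<in> X" and le: "(\<Sum>i\<in>I. f i y) \<le> (\<Sum>i\<in>I. f i c)"
    using \<open>c \<in> X\<close> by (auto simp: argmin_set_def is_arg_min_linorder)
  have min: "f j c \<le> f j w" if "j \<in> I" "w \<in> X" for j w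
    using c that by (auto simp: argmin_set_def is_arg_min_linorder)
  have "f i y \<le> f i c"
  proof (rule ccontr)
    assume "\<not> f i y \<le> f i c"
    then have "(\<Sum>i\<in>I. f i c) < (\<Sum>i\<in>I. f i y)"
      using \<open>finite I\<close> i min yX by (intro sum_strict_mono_ex1) (auto simp: not_le)
    with le show False by simp
  qed
  then show "y \<in> argmin_set X (f i)"
    using yX min[OF i] by (force simp: argmin_set_def is_arg_min_linorder)
qed

lemma closest_point_subgradient_descent:
  fixes X :: "'a::euclidean_space set"
  assumes X: "closed X" "convex X" and "y \<in> X"
    and lower: "\<And>w. w \<in> cball y \<sigma> \<Longrightarrow> h w < h z"
    and g: "g \<in> quasi_subdiff h z" "norm g = 1"
    and "\<sigma> \<ge> 0" "s \<ge> 0"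
  shows "(dist (closest_point X (z - s *\<^sub>R g)) y)\<^sup>2 \<le> (dist z y)\<^sup>2 - s * (2 * \<sigma> - s)"
proof -
  have gg: "g \<bullet> g = 1"
    using g(2) by (simp add: dot_square_norm)
  have "y + \<sigma> *\<^sub>R g \<in> cball y \<sigma>"
    using g(2) \<open>\<sigma> \<ge> 0\<close> by (simp add: dist_norm)
  then have "g \<bullet> (y + \<sigma> *\<^sub>R g - z) \<le> 0"
    using lower g(1) by (simp add: quasi_subdiff_def)
  then have "\<sigma> \<le> g \<bullet> (z - y)"
    using gg by (simp add: inner_diff_right inner_add_right)
  then have ang: "s * \<sigma> \<le> s * (g \<bullet> (z - y))"
    using \<open>s \<ge> 0\<close> by (rule mult_left_mono)
  have "dist (closest_point X (z - s *\<^sub>R g)) (closest_point X y) \<le> dist (z - s *\<^sub>R g) y"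
    using X \<open>y \<in> X\<close> by (intro closest_point_lipschitz) auto
  then have "(dist (closest_point X (z - s *\<^sub>R g)) y)\<^sup>2 \<le> (dist (z - s *\<^sub>R g) y)\<^sup>2"
    using \<open>y \<in> X\<close> by (simp add: closest_point_self power_mono)
  also have "\<dots> = (dist z y)\<^sup>2 - 2 * (s * (g \<bullet> (z - y))) + s * s"
    using gg by (simp add: dist_norm power2_norm_eq_inner algebra_simps inner_commute)
  also have "\<dots> \<le> (dist z y)\<^sup>2 - s * (2 * \<sigma> - s)"
    using ang by (simp add: algebra_simps)
  finally show ?thesis .
qed

text \<open>
  The descent is claimed only for \<open>z \<in> X\<close>: outside \<open>X\<close> the value \<open>h z\<close> may be below the minimum over
  \<open>X\<close>, and then a quasi-subgradient at \<open>z\<close> is not constrained by the ball.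
\<close>

lemma inner_step_cases:
  fixes X :: "'a::euclidean_space set"
  assumes X: "closed X" "convex X"
    and ball: "cball y \<sigma> \<subseteq> argmin_set X h" and "\<sigma> \<ge> 0" "s \<ge> 0"
    and step: "inner_step X h s z z'"
  obtains (stay) "h z = min_value X h" "z' = z"
    | (move) "z' \<in> X" "z \<in> X \<Longrightarrow> (dist z' y)\<^sup>2 \<le> (dist z y)\<^sup>2 - s * (2 * \<sigma> - s)"
proof (cases "h z = min_value X h")
  case True
  with step show ?thesis by (intro stay) (auto simp: inner_step_def)
next
  case False
  with step obtain g where g: "g \<in> quasi_subdiff h z" "norm g = 1"
    and z': "z' = closest_point X (z - s *\<^sub>R g)"
    by (auto simp: inner_step_def)
  have "y \<in> argmin_set X h"
    using ball \<open>\<sigma> \<ge> 0\<close> by auto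
  then have y: "y \<in> X" by (simp add: argmin_set_def is_arg_min_def)
  show ?thesis
  proof (rule move)
    show "z' \<in> X"
      unfolding z' using X y by (intro closest_point_in_set) auto
    assume zX: "z \<in> X"
    have "h w < h z" if "w \<in> cball y \<sigma>" for w
    proof -
      have w: "w \<in> argmin_set X h" using ball that by auto
      then have "h w \<le> h z" using zX by (simp add: argmin_set_def is_arg_min_linorder)
      then show ?thesis using False min_value_eq[OF w] by simp
    qed
    then show "(dist z' y)\<^sup>2 \<le> (dist z y)\<^sup>2 - s * (2 * \<sigma> - s)"
      unfolding z' using closest_point_subgradient_descent X y g assms(4,5) by blast
  qed
qed

text \<open>
  Until a component moves the point, the pass is still at its starting point, where all components
  visited so far are optimal; they cannot all be, as the sum is not.  So the pass moves, which puts
  it into \<open>X\<close>; from there on, steps with \<open>s \<le> 2 * \<sigma>\<close> never increase the distance to \<open>y\<close>.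
\<close>

lemma outer_step_descent:
  fixes X :: "'a::euclidean_space set"
  assumes X: "closed X" "convex X"
    and ball: "\<And>i. i \<in> {1..m} \<Longrightarrow> cball y \<sigma> \<subseteq> argmin_set X (f i)"
    and s: "0 \<le> s" "\<sigma> \<ge> 0"
    and nonopt: "(\<Sum>i=1..m. f i x) \<noteq> (\<Sum>i=1..m. min_value X (f i))"
    and step: "outer_step X m f s x x'"
  shows "x' \<in> X"
    and "x \<in> X \<Longrightarrow> s \<le> 2 * \<sigma> \<Longrightarrow> (dist x' y)\<^sup>2 \<le> (dist x y)\<^sup>2 - s * (2 * \<sigma> - s)"
proof -
  obtain z where z0: "z 0 = x" and zm: "x' = z m"
    and z: "\<And>i. i \<in> {1..m} \<Longrightarrow> inner_step X (f i) s (z (i - 1)) (z i)"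
    using step by (auto simp: outer_step_def)
  define D where "D w \<longleftrightarrow> w \<in> X \<and>
    (x \<in> X \<and> s \<le> 2 * \<sigma> \<longrightarrow> (dist w y)\<^sup>2 \<le> (dist x y)\<^sup>2 - s * (2 * \<sigma> - s))" for w
  have "(z j = x \<and> (\<forall>i\<in>{1..j}. f i x = min_value X (f i))) \<or> D (z j)" if "j \<le> m" for j
    using that
  proof (induction j)
    case 0
    then show ?case using z0 by simp
  next
    case (Suc j)
    then have Sj: "Suc j \<in> {1..m}" by simp
    have st: "inner_step X (f (Suc j)) s (z j) (z (Suc j))"
      using z[OF Sj] by simp
    note IH = Suc.IH[OF Suc_leD[OF Suc.prems]]
    from X ball[OF Sj] s(2,1) st show ?case
    proof (cases rule: inner_step_cases)
      case stay
      then show ?thesis using IH by (auto simp: atLeastAtMostSuc_conv)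
    next
      case move
      have "0 \<le> s * (2 * \<sigma> - s)" if "s \<le> 2 * \<sigma>"
        using that s by simp
      then have "D (z (Suc j))"
        using IH move unfolding D_def by force
      then show ?thesis by simp
    qed
  qed
  from this[of m] nonopt have "D x'"
    unfolding zm by auto
  then show "x' \<in> X"
    and "x \<in> X \<Longrightarrow> s \<le> 2 * \<sigma> \<Longrightarrow> (dist x' y)\<^sup>2 \<le> (dist x y)\<^sup>2 - s * (2 * \<sigma> - s)"
    unfolding D_def by auto
qed

lemma no_descent_with_divergent_steps:
  fixes d v :: "nat \<Rightarrow> real"
  assumes nonneg: "\<And>k. 0 \<le> d k"
    and "e > 0" and descent: "\<And>k. k \<ge> N \<Longrightarrow> d (Suc k) \<le> d k - e * v k"
    and div: "filterlim (\<lambda>n. \<Sum>k<n. v k) at_top sequentially"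
  shows False
proof -
  let ?S = "\<lambda>n. \<Sum>k<n. v k"
  let ?B = "d N + e * ?S N"
  have tele: "d n + e * ?S n \<le> ?B" if "n \<ge> N" for n
    using that
  proof (induction rule: dec_induct)
    case (step n)
    then show ?case using descent[of n] by (simp add: distrib_left)
  qed simp
  obtain M where "\<And>n. n \<ge> M \<Longrightarrow> ?B / e + 1 \<le> ?S n"
    using div unfolding filterlim_at_top eventually_sequentially by meson
  then have "?B / e + 1 \<le> ?S (max M N)" by simp
  then have "?B + e \<le> e * ?S (max M N)"
    using \<open>e > 0\<close> by (simp add: field_simps)
  then show False
    using tele[OF max.cobounded2[of N M]] nonneg[of "max M N"] \<open>e > 0\<close> by linarith
qed

text \<open>
  Both stepsize rules provide the same two things: divergence of the sum and an eventual gap below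
  \<open>2 * \<sigma>\<close>.  For constant steps the gap is \<open>2 * \<sigma> - c\<close>, positive because \<open>2 * \<sigma> / m \<le> 2 * \<sigma>\<close>; for
  vanishing steps any number below \<open>2 * \<sigma>\<close> serves, here \<open>\<sigma>\<close>.
\<close>

lemma stepsize_rules_gap:
  fixes v :: "nat \<Rightarrow> real"
  assumes "m \<ge> (1::nat)" "\<sigma> > 0"
    and "(\<exists>c. 0 < c \<and> c < 2 * \<sigma> / real m \<and> (\<forall>k. v k = c)) \<or>
       ((\<forall>k. v k > 0) \<and> v \<longlonglongrightarrow> 0 \<and> filterlim (\<lambda>N. \<Sum>k<N. v k) at_top sequentially)"
  obtains e N where "e > 0" "\<And>k. k \<ge> N \<Longrightarrow> v k \<le> 2 * \<sigma> - e" "\<And>k. v k > 0"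
    "filterlim (\<lambda>N. \<Sum>k<N. v k) at_top sequentially"
  using assms(3)
proof (elim disjE exE conjE)
  fix c assume c: "0 < c" "c < 2 * \<sigma> / real m" "\<forall>k. v k = c"
  have "2 * \<sigma> / real m \<le> 2 * \<sigma>"
    using assms(1,2) by (simp add: divide_le_eq)
  moreover have "filterlim (\<lambda>N. \<Sum>k<N. v k) at_top sequentially"
    using c by (simp add: filterlim_at_top_mult_tendsto_pos[OF tendsto_const] filterlim_real_sequentially)
  ultimately show thesis
    using c that[of "2 * \<sigma> - c" 0] by auto
next
  assume v: "\<forall>k. v k > 0" "v \<longlonglongrightarrow> 0" "filterlim (\<lambda>N. \<Sum>k<N. v k) at_top sequentially"
  from order_tendstoD(2)[OF v(2) \<open>\<sigma> > 0\<close>] obtain N where "\<And>k. k \<ge> N \<Longrightarrow> v k < \<sigma>"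
    by (auto simp: eventually_sequentially)
  then show thesis
    using v \<open>\<sigma> > 0\<close> that[of \<sigma> N] by (auto intro: less_imp_le)
qed

theorem theorem3p4:
  fixes X :: "(real ^ 'n) set"
    and m :: nat
    and f :: "nat \<Rightarrow> real ^ 'n \<Rightarrow> real"
    and p \<sigma> :: real
    and L v :: "nat \<Rightarrow> real"
    and x :: "nat \<Rightarrow> real ^ 'n"
    and K :: enat
    and xs :: "real ^ 'n"
  defines "F \<equiv> (\<lambda>y. \<Sum>i=1..m. f i y)"
  assumes X: "X \<noteq> {}" "closed X" "convex X"
    and m: "m \<ge> 1"
    and f_cont: "\<And>i. i \<in> {1..m} \<Longrightarrow> continuous_on UNIV (f i)"
    and f_qc: "\<And>i. i \<in> {1..m} \<Longrightarrow> quasi_convex (f i)"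
    and common_opt: "(\<Inter>i\<in>{1..m}. argmin_set X (f i)) \<noteq> {}"
    and p: "p > 0"
    and L: "\<And>i. i \<in> {1..m} \<Longrightarrow> L i > 0"
    and hoelder: "\<And>i a b. i \<in> {1..m} \<Longrightarrow> a \<in> X \<Longrightarrow> \<bar>f i b - f i a\<bar> \<le> L i * norm (b - a) powr p"
    and run: "incremental_subgradient_run X m f v x K"
    and start: "x 0 \<in> X \<or> F (x 0) > min_value X F"
    and xs: "xs \<in> argmin_set X F"
    and \<sigma>: "\<sigma> > 0"
    and ball: "cball xs \<sigma> \<subseteq> argmin_set X F"
    and stepsize:
      "(\<exists>c. 0 < c \<and> c < 2 * \<sigma> / real m \<and> (\<forall>k. v k = c)) \<or>
       ((\<forall>k. v k > 0) \<and> v \<longlonglongrightarrow> 0 \<and> filterlim (\<lambda>N. \<Sum>k<N. v k) at_top sequentially)"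
  shows "\<exists>k. enat k \<le> K \<and> x k \<in> argmin_set X F"
proof -
  obtain c where c: "c \<in> (\<Inter>i\<in>{1..m}. argmin_set X (f i))"
    using common_opt by auto
  then have sub: "argmin_set X F \<subseteq> argmin_set X (f i)" if "i \<in> {1..m}" for i
    unfolding F_def using c that by (intro argmin_set_sum_subset) auto
  have balls: "cball xs \<sigma> \<subseteq> argmin_set X (f i)" if "i \<in> {1..m}" for i
    using ball sub[OF that] by blast
  have "min_value X F = (\<Sum>i=1..m. f i xs)"
    using min_value_eq[OF xs] by (simp add: F_def)
  also have "\<dots> = (\<Sum>i=1..m. min_value X (f i))"
    using xs sub by (intro sum.cong refl min_value_eq[symmetric]) blast
  finally have minF: "min_value X F = (\<Sum>i=1..m. min_value X (f i))" .
  have argminI: "w \<in> argmin_set X F" if "w \<in> X" "\<not> F w > min_value X F" for w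
    using that xs min_value_eq[OF xs] by (force simp: argmin_set_def is_arg_min_linorder)
  obtain e N where e: "e > 0" and gap: "\<And>k. k \<ge> N \<Longrightarrow> v k \<le> 2 * \<sigma> - e"
    and vpos: "\<And>k. v k > 0" and div: "filterlim (\<lambda>N. \<Sum>k<N. v k) at_top sequentially"
    using stepsize_rules_gap[OF m \<sigma> stepsize] by blast
  have go: "F (x k) > min_value X F" "outer_step X m f (v k) (x k) (x (Suc k))" if "enat k < K" for k
    using run that by (auto simp: incremental_subgradient_run_def F_def Let_def)
  have stop: "\<not> F (x k) > min_value X F" if "enat k = K" for k
    using run that by (auto simp: incremental_subgradient_run_def F_def Let_def)
  have nonopt: "(\<Sum>i=1..m. f i (x k)) \<noteq> (\<Sum>i=1..m. min_value X (f i))" if "enat k < K" for k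
    using go(1)[OF that] minF by (simp add: F_def)
  have inX: "x (Suc k) \<in> X" if "enat k < K" for k
    by (rule outer_step_descent(1)[OF X(2,3) balls _ _ nonopt[OF that] go(2)[OF that]])
      (use \<sigma> vpos[of k] in auto)
  show ?thesis
  proof (cases K)
    case (enat n)
    have "x n \<in> X"
    proof (cases n)
      case 0
      then show ?thesis using start stop enat by auto
    next
      case (Suc n')
      then show ?thesis using inX[of n'] enat by simp
    qed
    then show ?thesis
      using argminI stop enat by (intro exI[of _ n]) simp
  next
    case infinity
    let ?d = "\<lambda>k. (dist (x k) xs)\<^sup>2"
    \<comment> \<open>The index 0 is left out because \<open>x 0\<close> may lie outside \<open>X\<close>.\<close>
    have "?d (Suc k) \<le> ?d k - e * v k" if "k \<ge> max 1 N" for k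
    proof -
      have k: "enat k < K" using infinity by simp
      have "x k \<in> X" using inX[of "k - 1"] that infinity by simp
      moreover have "v k \<le> 2 * \<sigma>" using gap[of k] that e by simp
      ultimately have "?d (Suc k) \<le> ?d k - v k * (2 * \<sigma> - v k)"
        by (intro outer_step_descent(2)[OF X(2,3) balls _ _ nonopt[OF k] go(2)[OF k]])
          (use \<sigma> vpos[of k] in auto)
      moreover have "v k * e \<le> v k * (2 * \<sigma> - v k)"
        using gap[of k] that vpos[of k] by (intro mult_left_mono) auto
      ultimately show ?thesis by (simp add: mult.commute)
    qed
    then show ?thesis
      using no_descent_with_divergent_steps[of ?d e "max 1 N" v] e div by auto
  qed
qed

end
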